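(* Consider $A\in\mathbb{R}^{m\times d}$ and $b\in\mathbb{R}^m$. Let $F,G\subseteq\mathbb{R}^d\times\mathbb{R}^m\times\mathbb{S}^{(d+m)\times(d+m)}$ be defined by $$ F=\left\{(z,s,M)\;\middle|\; Az+s=b,\; s\ge 0,\; M=\begin{bmatrix}z\\ s\end{bmatrix}\begin{bmatrix}z\\ s\end{bmatrix}^T\right\}, $$ $$ G=\left\{(z,s,M)\;\middle|\; \begin{array}{l} Az+s=b,\quad s\ge 0,\\ \begin{bmatrix}A & I\end{bmatrix}M\begin{bmatrix}A^T\\ I\end{bmatrix}=bb^T,\quad \begin{bmatrix}M & \begin{bmatrix}z\\ s\end{bmatrix}\\ \begin{bmatrix}z^T & s^T\end{bmatrix} & 1\end{bmatrix}\succeq 0 \end{array}\right\}. $$ Then $F\subseteq G$.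
   Context: $\mathbb{S}^{k\times k}$ denotes the set of real symmetric $k\times k$ matrices, $I$ is the $m\times m$ identity matrix, and $\succeq 0$ means positive semidefinite. Vector inequalities are component-wise. *)

theory Defs
  imports "Jordan_Normal_Form.Matrix"
begin

definition symmetric_mats :: "nat \<Rightarrow> real mat set" where
  "symmetric_mats k = {M \<in> carrier_mat k k. M\<^sup>T = M}"

definition psd :: "real mat \<Rightarrow> bool" where
  "psd M \<longleftrightarrow> M \<in> symmetric_mats (dim_row M) \<and>
     (\<forall>x \<in> carrier_vec (dim_row M). 0 \<le> x \<bullet> (M *\<^sub>v x))"

definition column_mat :: "'a vec \<Rightarrow> 'a mat" where
  "column_mat v = mat_of_cols (dim_vec v) [v]"

text \<open>The block row \<open>[A B]\<close>, obtained from \<^const>\<open>four_block_mat\<close> with a lower half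
  that has no rows (as \<^const>\<open>append_rows\<close> does with columns).\<close>

definition append_cols :: "'a :: zero mat \<Rightarrow> 'a mat \<Rightarrow> 'a mat" where
  "append_cols A B = four_block_mat A B (0\<^sub>m 0 (dim_col A)) (0\<^sub>m 0 (dim_col B))"

text \<open>In both sets \<open>z @\<^sub>v s\<close> is the stacked vector of \<open>z\<close> and \<open>s\<close>; the order \<open>\<le>\<close> on
  \<^typ>\<open>real vec\<close> is component-wise.\<close>

definition F_set :: "nat \<Rightarrow> nat \<Rightarrow> real mat \<Rightarrow> real vec \<Rightarrow> (real vec \<times> real vec \<times> real mat) set" where
  "F_set m d A b =
     {(z, s, M). z \<in> carrier_vec d \<and> s \<in> carrier_vec m \<and> M \<in> symmetric_mats (d + m) \<and>
        A *\<^sub>v z + s = b \<and> 0\<^sub>v m \<le> s \<and>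
        M = column_mat (z @\<^sub>v s) * (column_mat (z @\<^sub>v s))\<^sup>T}"

definition G_set :: "nat \<Rightarrow> nat \<Rightarrow> real mat \<Rightarrow> real vec \<Rightarrow> (real vec \<times> real vec \<times> real mat) set" where
  "G_set m d A b =
     {(z, s, M). z \<in> carrier_vec d \<and> s \<in> carrier_vec m \<and> M \<in> symmetric_mats (d + m) \<and>
        A *\<^sub>v z + s = b \<and> 0\<^sub>v m \<le> s \<and>
        append_cols A (1\<^sub>m m) * M * (A\<^sup>T @\<^sub>r 1\<^sub>m m) = column_mat b * (column_mat b)\<^sup>T \<and>
        psd (four_block_mat M (column_mat (z @\<^sub>v s)) ((column_mat (z @\<^sub>v s))\<^sup>T) (1\<^sub>m 1))}"

end

theory Submission
  imports Defs
begin

text \<open>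
  With \<open>x = z @\<^sub>v s\<close>, a point of the smaller set has \<open>M = x x\<^sup>T\<close>, and both defining
  conditions of the larger set become statements about outer products of vectors.
  The linear constraint reads \<open>[A I] x = b\<close>, so multiplying \<open>x x\<^sup>T\<close> by \<open>[A I]\<close> on the
  left and by its transpose on the right gives \<open>b b\<^sup>T\<close> (\<open>mat_mult_column_mat\<close>,
  \<open>append_cols_mult_append_vec\<close>, \<open>transpose_append_cols\<close>).  The bordered matrix is
  again an outer product, namely that of \<open>x\<close> extended by an entry 1
  (\<open>outer_product_bordered\<close>), and an outer product \<open>v v\<^sup>T\<close> is positive semidefinite
  because its quadratic form at \<open>y\<close> is the square of \<open>v \<bullet> y\<close> (\<open>psd_outer_product\<close>).
\<close>

lemma column_mat_carrier: "column_mat v \<in> carrier_mat (dim_vec v) 1"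
  by (metis column_mat_def length_Cons list.size(3) mat_of_cols_carrier(1) One_nat_def)

lemma dim_row_column_mat [simp]: "dim_row (column_mat v) = dim_vec v"
  and dim_col_column_mat [simp]: "dim_col (column_mat v) = 1"
  by (simp_all add: column_mat_def)

lemma index_column_mat [simp]: "i < dim_vec v \<Longrightarrow> column_mat v $$ (i, 0) = v $ i"
  by (simp add: column_mat_def mat_of_cols_index)

lemma col_column_mat [simp]: "col (column_mat v) 0 = v"
  by (simp add: column_mat_def)

lemma index_outer_product:
  fixes v w :: "'a :: semiring_0 vec"
  assumes "i < dim_vec v" and "j < dim_vec w"
  shows "(column_mat v * (column_mat w)\<^sup>T) $$ (i, j) = v $ i * w $ j"
  using assms by (simp add: scalar_prod_def)

lemma mat_mult_column_mat:
  fixes C :: "'a :: semiring_0 mat"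
  shows "C * column_mat v = column_mat (C *\<^sub>v v)"
  by (rule eq_matI) (auto simp: less_Suc_eq)

lemma append_cols_carrier:
  assumes "A \<in> carrier_mat m d" and "B \<in> carrier_mat m k"
  shows "append_cols A B \<in> carrier_mat m (d + k)"
  using assms by (auto simp: append_cols_def)

lemma append_cols_mult_append_vec:
  fixes A B :: "'a :: semiring_0 mat"
  assumes A: "A \<in> carrier_mat m d" and B: "B \<in> carrier_mat m k"
    and z: "z \<in> carrier_vec d" and s: "s \<in> carrier_vec k"
  shows "append_cols A B *\<^sub>v (z @\<^sub>v s) = A *\<^sub>v z + B *\<^sub>v s"
proof (rule eq_vecI)
  fix i assume "i < dim_vec (A *\<^sub>v z + B *\<^sub>v s)"
  then have i: "i < m" using B by simp
  have "row (append_cols A B) i = row A i @\<^sub>v row B i"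
    using A B i by (auto simp: append_cols_def)
  then show "(append_cols A B *\<^sub>v (z @\<^sub>v s)) $ i = (A *\<^sub>v z + B *\<^sub>v s) $ i"
    using A B z s i append_cols_carrier[OF A B]
    by (simp add: scalar_prod_append[of _ d _ k])
qed (use A B append_cols_carrier[OF A B] in simp)

lemma transpose_append_cols:
  assumes "A \<in> carrier_mat m d" and "B \<in> carrier_mat m k"
  shows "(append_cols A B)\<^sup>T = A\<^sup>T @\<^sub>r B\<^sup>T"
  using assms
  by (auto simp: append_cols_def append_rows_def transpose_four_block_mat[of _ m d _ k _ 0])

text \<open>A rank-one matrix \<open>v v\<^sup>T\<close> maps every vector \<open>y\<close> onto the line spanned by \<open>v\<close>, which
  leaves the same factor \<open>v \<bullet> y\<close> twice in the quadratic form.\<close>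

lemma psd_outer_product: "psd (column_mat v * (column_mat v)\<^sup>T)"
proof -
  let ?V = "column_mat v" and ?n = "dim_vec v"
  have sym: "(?V * ?V\<^sup>T)\<^sup>T = ?V * ?V\<^sup>T"
    by (subst transpose_mult[of _ ?n 1 _ ?n]) (simp_all add: column_mat_carrier del: One_nat_def)
  have "0 \<le> y \<bullet> ((?V * ?V\<^sup>T) *\<^sub>v y)" if y: "y \<in> carrier_vec ?n" for y
  proof -
    have "(?V * ?V\<^sup>T) *\<^sub>v y = (v \<bullet> y) \<cdot>\<^sub>v v"
      using y by (intro eq_vecI)
        (auto simp: scalar_prod_def sum_distrib_left sum_distrib_right ac_simps intro!: sum.cong)
    then have "y \<bullet> ((?V * ?V\<^sup>T) *\<^sub>v y) = (v \<bullet> y) * (v \<bullet> y)"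
      using y by (simp add: comm_scalar_prod[of y ?n v])
    then show ?thesis by simp
  qed
  with sym show ?thesis
    by (auto simp: psd_def symmetric_mats_def)
qed

text \<open>Bordering \<open>x x\<^sup>T\<close> by \<open>x\<close> and the entry 1 keeps it of rank one, which is what
  makes the semidefinite constraint hold for free.\<close>

lemma outer_product_bordered:
  fixes x :: "'a :: semiring_1 vec"
  defines "v \<equiv> x @\<^sub>v vec 1 (\<lambda>_. 1)"
  shows "four_block_mat (column_mat x * (column_mat x)\<^sup>T) (column_mat x) ((column_mat x)\<^sup>T) (1\<^sub>m 1)
    = column_mat v * (column_mat v)\<^sup>T" (is "?L = ?R")
proof (rule eq_matI)
  fix i j assume "i < dim_row ?R" and "j < dim_col ?R"
  then have i: "i < Suc (dim_vec x)" and j: "j < Suc (dim_vec x)"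
    by (simp_all add: v_def)
  have "?R $$ (i, j) = v $ i * v $ j"
    using i j by (intro index_outer_product) (simp_all add: v_def)
  then show "?L $$ (i, j) = ?R $$ (i, j)"
    using i j by (auto simp: v_def index_outer_product less_Suc_eq simp del: index_mult_mat(1))
qed (simp_all add: v_def)

theorem proposition4p5:
  fixes A :: "real mat" and b :: "real vec" and m d :: nat
  assumes "A \<in> carrier_mat m d" and "b \<in> carrier_vec m"
  shows "F_set m d A b \<subseteq> G_set m d A b"
proof -
  let ?C = "append_cols A (1\<^sub>m m)"
  have C: "?C \<in> carrier_mat m (d + m)"
    using append_cols_carrier[OF assms(1) one_carrier_mat] .
  have CT: "A\<^sup>T @\<^sub>r 1\<^sub>m m = ?C\<^sup>T"
    using transpose_append_cols[OF assms(1) one_carrier_mat] by simp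
  have "?C * (column_mat (z @\<^sub>v s) * (column_mat (z @\<^sub>v s))\<^sup>T) * (A\<^sup>T @\<^sub>r 1\<^sub>m m)
      = column_mat b * (column_mat b)\<^sup>T"
    if z: "z \<in> carrier_vec d" and s: "s \<in> carrier_vec m" and eq: "A *\<^sub>v z + s = b" for z s
  proof -
    let ?X = "column_mat (z @\<^sub>v s)"
    have X: "?X \<in> carrier_mat (d + m) 1"
      using z s by (metis append_carrier_vec carrier_vecD column_mat_carrier)
    have CX: "?C * ?X = column_mat b"
      using append_cols_mult_append_vec[OF assms(1) one_carrier_mat z s] s eq
      by (simp add: mat_mult_column_mat)
    have XT: "?X\<^sup>T \<in> carrier_mat 1 (d + m)" and CT': "?C\<^sup>T \<in> carrier_mat (d + m) m"
      using X C by simp_all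
    have "?C * (?X * ?X\<^sup>T) * ?C\<^sup>T = ?C * ?X * ?X\<^sup>T * ?C\<^sup>T"
      by (simp only: assoc_mult_mat[OF C X XT])
    also have "\<dots> = ?C * ?X * (?X\<^sup>T * ?C\<^sup>T)"
      by (rule assoc_mult_mat[OF mult_carrier_mat[OF C X] XT CT'])
    also have "\<dots> = (?C * ?X) * (?C * ?X)\<^sup>T"
      by (simp only: transpose_mult[OF C X])
    finally show ?thesis by (simp only: CX CT)
  qed
  moreover have "psd (four_block_mat (column_mat x * (column_mat x)\<^sup>T) (column_mat x)
      ((column_mat x)\<^sup>T) (1\<^sub>m 1))" for x
    by (simp only: outer_product_bordered psd_outer_product)
  ultimately show ?thesis
    by (auto simp: F_set_def G_set_def simp del: One_nat_def)
qed

end
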